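(* Let $d\ge 1$ and let $\mathbf{s}=(s_1,\ldots,s_d)$ be a sequence of positive integers such that $s_1=\cdots=s_i$ for some $1\le i\le d$, and $s_j<s_{j+1}$ for all $i\le j\le d-1$. Then $\mathbf{P}_d^{(\mathbf{s})}$ is translation equivalent to a Fano polytope if and only if $s_1=\cdots=s_i=i+1$ and $s_{j+1}\le 2s_j$ for all $i\le j\le d-1$. Moreover, in this case the unique interior lattice point of $\mathbf{P}_d^{(\mathbf{s})}$ is $(x_d,\ldots,x_1)^T=(s_d-1,\ldots,s_{i+1}-1,i,i-1,\ldots,2,1)^T$.
   Context: For a sequence of positive integers $\mathbf{s}=(s_1,\ldots,s_d)$, the $\mathbf{s}$-lecture hall polytope is $\mathbf{P}_d^{(\mathbf{s})}=\{\mathbf{x}\in\mathbb{R}^d : 0\le \frac{x_1}{s_1}\le\frac{x_2}{s_2}\le\cdots\le\frac{x_d}{s_d}\le 1\}$, a $d$-dimensional lattice polytope. Points are written as column vectors with $x_d$ as first entry and $x_1$ as last entry. A $d$-dimensional lattice polytope $\mathcal{P}\subset\mathbb{R}^d$ is Fano if $(\mathcal{P}\setminus\partial\mathcal{P})\cap\mathbb{Z}^d=\{\mathbf{0}\}$. Two lattice polytopes are translation equivalent if one is the translate of the other by a vector in $\mathbb{Z}^d$. *)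

theory Defs
  imports "HOL-Analysis.Analysis"
begin

definition integer_points :: "(real ^ 'n) set" where
  "integer_points = {x. \<forall>k. x $ k \<in> \<int>}"

definition lattice_polytope :: "(real ^ 'n) set \<Rightarrow> bool" where
  "lattice_polytope P \<longleftrightarrow>
     (\<exists>V. finite V \<and> V \<subseteq> integer_points \<and> P = convex hull V)"

definition fano_polytope :: "(real ^ 'n) set \<Rightarrow> bool" where
  "fano_polytope P \<longleftrightarrow>
     lattice_polytope P \<and> aff_dim P = int CARD('n) \<and>
     (P - frontier P) \<inter> integer_points = {0}"

definition translation_equivalent :: "(real ^ 'n) set \<Rightarrow> (real ^ 'n) set \<Rightarrow> bool" where
  "translation_equivalent P Q \<longleftrightarrow> (\<exists>v \<in> integer_points. Q = (\<lambda>x. v + x) ` P)"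

text \<open>
  The index type of the vectors carries no order, so the argument \<open>c\<close> labels the
  coordinates: it is meant to be a bijection from \<open>{1..d}\<close> onto the index type, and the
  coordinate \<open>x\<^sub>j\<close> is \<open>x $ c j\<close>. Only the entries \<open>s 1, \<dots>, s d\<close> are used.
\<close>

definition lecture_hall_polytope ::
    "(nat \<Rightarrow> 'n) \<Rightarrow> nat \<Rightarrow> (nat \<Rightarrow> nat) \<Rightarrow> (real ^ 'n) set" where
  "lecture_hall_polytope c d s =
     {x. 0 \<le> x $ c 1 / real (s 1) \<and>
         (\<forall>j \<in> {1..<d}. x $ c j / real (s j) \<le> x $ c (j + 1) / real (s (j + 1))) \<and>
         x $ c d / real (s d) \<le> 1}"

end

(* Interior points are those for which every defining inequality is strict, so an interior lattice
   point satisfies 0 < x_1 < ... < x_i < s_1 on the constant block. Hence s_1 >= i + 1; the shifts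
   of (1, ..., i) give two interior points once s_1 >= i + 2, and s_1 = i + 1 forces x_j = j.
   Beyond the block write x_j = s_j - e_j. The inequalities say that e_j / s_j is strictly
   decreasing, so e_j = 1 leaves only e_(j+1) = 1 exactly when s_(j+1) <= 2 s_j. *)

theory Submission imports Defs begin

lemma interior_INT:
  assumes "finite A"
  shows "interior (\<Inter>k\<in>A. S k) = (\<Inter>k\<in>A. interior (S k))"
  using assms by induction simp_all

section \<open>Lecture hall polytopes as intersections of halfspaces\<close>

locale lecture_hall =
  fixes d :: nat and s :: "nat \<Rightarrow> nat" and c :: "nat \<Rightarrow> 'n::finite"
  assumes d_pos: "d \<ge> 1"
    and bij_c: "bij_betw c {1..d} UNIV"
    and s_pos: "\<And>j. j \<in> {1..d} \<Longrightarrow> s j > 0"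
begin

abbreviation P :: "(real ^ 'n) set" where
  "P \<equiv> lecture_hall_polytope c d s"

(* The conventions 0 at index 0 and 1 beyond d turn all d + 1 defining inequalities of the
   polytope into monotonicity of one sequence. *)
definition ratio :: "real ^ 'n \<Rightarrow> nat \<Rightarrow> real" where
  "ratio x k = (if k = 0 then 0 else if k \<le> d then x $ c k / real (s k) else 1)"

text \<open>The linear part of \<open>ratio\<close> as a normal vector, which gives access to the
  library facts on halfspaces. It vanishes at the conventional indices, where \<open>ratio\<close>
  is constant.\<close>

definition ratio_form :: "nat \<Rightarrow> real ^ 'n" where
  "ratio_form k = (if k \<in> {1..d} then axis (c k) (1 / real (s k)) else 0)"

definition point :: "(nat \<Rightarrow> real) \<Rightarrow> real ^ 'n" where
  "point f = (\<chi> n. f (inv_into {1..d} c n))"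

lemma c_eq_iff: "j \<in> {1..d} \<Longrightarrow> k \<in> {1..d} \<Longrightarrow> c j = c k \<longleftrightarrow> j = k"
  using bij_c by (meson bij_betw_imp_inj_on inj_on_eq_iff)

lemma all_coords_iff: "(\<forall>n. Q n) \<longleftrightarrow> (\<forall>j\<in>{1..d}. Q (c j))"
  using bij_c by (metis UNIV_I bij_betw_imp_surj_on imageE)

lemma vec_eq_coords: "x = y \<longleftrightarrow> (\<forall>j\<in>{1..d}. x $ c j = y $ c j)" for x y :: "real ^ 'n"
  by (simp add: vec_eq_iff all_coords_iff)

lemma integer_points_iff: "x \<in> integer_points \<longleftrightarrow> (\<forall>j\<in>{1..d}. x $ c j \<in> \<int>)"
  by (auto simp: integer_points_def all_coords_iff)

lemma point_nth [simp]: "j \<in> {1..d} \<Longrightarrow> point f $ c j = f j"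
  using bij_c by (simp add: point_def bij_betw_inv_into_left)

lemma ratio_eq_inner: "ratio x k = ratio_form k \<bullet> x + (if k \<le> d then 0 else 1)"
  by (auto simp: ratio_def ratio_form_def inner_axis')

lemma ratio_form_nth:
  "j \<in> {1..d} \<Longrightarrow> ratio_form k $ c j = (if k = j then 1 / real (s j) else 0)"
  by (auto simp: ratio_form_def axis_def c_eq_iff)

text \<open>A halfspace has the expected interior only if its normal is nonzero. Coordinate
  \<open>c k\<close> witnesses this, except for \<open>k = 0\<close>, where the first form is zero
  and coordinate \<open>c 1\<close> of the second one serves.\<close>

lemma ratio_form_diff_nonzero:
  assumes "k \<le> d"
  shows "ratio_form k - ratio_form (Suc k) \<noteq> 0"
proof (cases "k = 0")
  case True
  have "(ratio_form k - ratio_form (Suc k)) $ c 1 \<noteq> 0"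
    using True d_pos s_pos[of 1] by (simp add: ratio_form_nth)
  then show ?thesis by auto
next
  case False
  have "(ratio_form k - ratio_form (Suc k)) $ c k \<noteq> 0"
    using False assms s_pos[of k] by (simp add: ratio_form_nth)
  then show ?thesis by auto
qed

lemma mem_iff_ratio: "x \<in> P \<longleftrightarrow> (\<forall>k\<le>d. ratio x k \<le> ratio x (Suc k))"
proof
  assume x: "x \<in> P"
  show "\<forall>k\<le>d. ratio x k \<le> ratio x (Suc k)"
  proof (intro allI impI)
    fix k assume "k \<le> d"
    then consider "k = 0" | "k = d" "k \<noteq> 0" | "k \<in> {1..<d}" by fastforce
    then show "ratio x k \<le> ratio x (Suc k)"
      using x d_pos by cases (auto simp: lecture_hall_polytope_def ratio_def)
  qed
next
  assume R: "\<forall>k\<le>d. ratio x k \<le> ratio x (Suc k)"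
  have "ratio x 0 \<le> ratio x 1" "ratio x d \<le> ratio x (Suc d)"
    "\<forall>k\<in>{1..<d}. ratio x k \<le> ratio x (k + 1)"
    using R by auto
  then show "x \<in> P"
    using d_pos by (auto simp: lecture_hall_polytope_def ratio_def)
qed

lemma ratio_diff:
  assumes "k \<le> d"
  shows "ratio x k - ratio x (Suc k) =
    (ratio_form k - ratio_form (Suc k)) \<bullet> x - (if k = d then 1 else 0)"
  using assms by (auto simp: ratio_eq_inner inner_diff_left)

lemma ratio_le_iff:
  "k \<le> d \<Longrightarrow> ratio x k \<le> ratio x (Suc k) \<longleftrightarrow>
    (ratio_form k - ratio_form (Suc k)) \<bullet> x \<le> (if k = d then 1 else 0)"
  using ratio_diff[of k x] by linarith

lemma ratio_less_iff:
  "k \<le> d \<Longrightarrow> ratio x k < ratio x (Suc k) \<longleftrightarrow>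
    (ratio_form k - ratio_form (Suc k)) \<bullet> x < (if k = d then 1 else 0)"
  using ratio_diff[of k x] by linarith

lemma P_eq_halfspaces:
  "P = (\<Inter>k\<in>{..d}. {x. (ratio_form k - ratio_form (Suc k)) \<bullet> x \<le> (if k = d then 1 else 0)})"
  by (auto simp: mem_iff_ratio ratio_le_iff simp del: if_split)

lemma convex_P: "convex P"
  unfolding P_eq_halfspaces by (intro convex_INT convex_halfspace_le)

text \<open>Interior commutes with finite intersections, and each halfspace here has a nonzero
  normal, so its interior is the open halfspace.\<close>

lemma interior_P: "interior P = {x. \<forall>k\<le>d. ratio x k < ratio x (Suc k)}"
proof -
  have "interior P =
    (\<Inter>k\<in>{..d}. {x. (ratio_form k - ratio_form (Suc k)) \<bullet> x < (if k = d then 1 else 0)})"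
    unfolding P_eq_halfspaces
    by (subst interior_INT) (auto intro!: INF_cong interior_halfspace_le ratio_form_diff_nonzero)
  also have "\<dots> = (\<Inter>k\<in>{..d}. {x. ratio x k < ratio x (Suc k)})"
    by (intro INF_cong) (simp_all add: ratio_less_iff)
  finally show ?thesis by auto
qed

text \<open>The polytope is a simplex, and the barycentric coordinates of a point are the gaps
  between its consecutive ratios.\<close>

lemma lattice_polytope_P: "lattice_polytope P"
proof -
  \<comment> \<open>The ratios of \<open>v k\<close> jump from 0 to 1 right after index
    \<open>k\<close>, so all defining inequalities but one are equalities there: these are the
    vertices.\<close>
  define v where "v k = point (\<lambda>j. if k < j then real (s j) else 0)" for k
  have v_nth: "v k $ c j = (if k < j then real (s j) else 0)" if "j \<in> {1..d}" for j k
    using that by (simp add: v_def)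
  have v_ratio: "ratio (v k) j = (if k < j then 1 else 0)" if "k \<le> d" for k j
    using that s_pos[of j] by (auto simp: ratio_def v_nth)
  have "convex hull (v ` {..d}) \<subseteq> P"
    by (rule hull_minimal) (auto simp: mem_iff_ratio v_ratio convex_P)
  moreover have "P \<subseteq> convex hull (v ` {..d})"
  proof
    fix x assume x: "x \<in> P"
    \<comment> \<open>Nonnegative by membership in \<open>P\<close>; the sum telescopes to 1 because
      \<open>ratio\<close> runs from 0 at index 0 to 1 at index \<open>Suc d\<close>.\<close>
    define w where "w k = ratio x (Suc k) - ratio x k" for k
    have tele: "(\<Sum>k<j. w k) = ratio x j" for j
      unfolding w_def by (subst sum_lessThan_telescope) (simp add: ratio_def)
    have "(\<Sum>k\<in>{..d}. w k *\<^sub>R v k) \<in> convex hull (v ` {..d})"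
    proof (rule convex_sum)
      show "sum w {..d} = 1"
        using tele[of "Suc d"] by (simp add: lessThan_Suc_atMost ratio_def)
    qed (use x in \<open>auto simp: w_def mem_iff_ratio hull_inc\<close>)
    moreover have "(\<Sum>k\<in>{..d}. w k *\<^sub>R v k) = x"
      unfolding vec_eq_coords
    proof
      fix j assume j: "j \<in> {1..d}"
      have "(\<Sum>k\<in>{..d}. w k *\<^sub>R v k) $ c j = (\<Sum>k\<in>{..d}. if k < j then w k * real (s j) else 0)"
        using j by (auto simp: v_nth intro!: sum.cong)
      also have "\<dots> = (\<Sum>k<j. w k * real (s j))"
        using j by (intro sum.mono_neutral_cong_right) auto
      also have "\<dots> = ratio x j * real (s j)"
        by (simp add: tele flip: sum_distrib_right)
      also have "\<dots> = x $ c j"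
        using j s_pos[of j] by (simp add: ratio_def)
      finally show "(\<Sum>k\<in>{..d}. w k *\<^sub>R v k) $ c j = x $ c j" .
    qed
    ultimately show "x \<in> convex hull (v ` {..d})" by simp
  qed
  moreover have "v ` {..d} \<subseteq> integer_points"
    by (auto simp: integer_points_iff v_nth)
  ultimately show ?thesis
    unfolding lattice_polytope_def by (intro exI[of _ "v ` {..d}"]) auto
qed

section \<open>Coordinates of interior points\<close>

lemma interior_ratio_less:
  assumes "x \<in> interior P" "j \<in> {1..<d}"
  shows "x $ c j / real (s j) < x $ c (Suc j) / real (s (Suc j))"
proof -
  have "ratio x j < ratio x (Suc j)"
    using assms by (auto simp: interior_P)
  then show ?thesis using assms by (simp add: ratio_def)
qed

lemma interior_first_pos:
  assumes "x \<in> interior P"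
  shows "x $ c 1 > 0"
proof -
  have "ratio x 0 < ratio x (Suc 0)"
    using assms by (auto simp: interior_P)
  then show ?thesis
    using d_pos s_pos[of 1] by (simp add: ratio_def zero_less_divide_iff)
qed

lemma interior_less:
  assumes x: "x \<in> interior P" and j: "j \<in> {1..d}"
  shows "x $ c j < real (s j)"
proof -
  have "ratio x j < 1"
  proof -
    have "j \<le> d" using j by simp
    then show ?thesis
    \<comment> \<open>Downward from index \<open>d\<close>, following the increasing chain of ratios
      that ends in 1.\<close>
    proof (induction rule: inc_induct)
      case base
      have "ratio x d < ratio x (Suc d)" using x by (auto simp: interior_P)
      then show ?case by (simp add: ratio_def)
    next
      case (step k)
      have "ratio x k < ratio x (Suc k)" using x step by (auto simp: interior_P)
      then show ?case using step by simp
    qed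
  qed
  then show ?thesis
    using j s_pos[of j] by (simp add: ratio_def)
qed

text \<open>With x_j = s_j - e_j, clearing denominators turns x_j / s_j < x_(j+1) / s_(j+1) into the
  third hypothesis; the first two are the end conditions 0 < x_1 and x_d < s_d.\<close>

lemma point_in_interior:
  assumes "e 1 < real (s 1)" "e d > 0"
    and "\<And>j. j \<in> {1..<d} \<Longrightarrow> e (Suc j) * real (s j) < e j * real (s (Suc j))"
  shows "point (\<lambda>j. real (s j) - e j) \<in> interior P"
  unfolding interior_P
proof (intro CollectI allI impI)
  fix k assume "k \<le> d"
  then consider "k = 0" | "k = d" "k \<noteq> 0" | "k \<in> {1..<d}" by fastforce
  then show "ratio (point (\<lambda>j. real (s j) - e j)) k
    < ratio (point (\<lambda>j. real (s j) - e j)) (Suc k)"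
  proof cases
    case 3
    then show ?thesis
      using assms(3)[OF 3] s_pos[of k] s_pos[of "Suc k"]
      by (simp add: ratio_def field_simps)
  qed (use d_pos assms(1,2) s_pos[of 1] s_pos[of d] in \<open>auto simp: ratio_def\<close>)
qed

end

section \<open>Fano translates and unique interior lattice points\<close>

lemma minus_frontier: "S - frontier S = interior S"
  using interior_subset[of S] closure_subset[of S] by (auto simp: frontier_def)

lemma integer_points_add: "x \<in> integer_points \<Longrightarrow> y \<in> integer_points \<Longrightarrow> x + y \<in> integer_points"
  by (simp add: integer_points_def)

lemma integer_points_minus: "x \<in> integer_points \<Longrightarrow> - x \<in> integer_points"
  by (simp add: integer_points_def)

lemma lattice_polytope_translation:
  assumes "lattice_polytope S" "v \<in> integer_points"
  shows "lattice_polytope ((+) v ` S)"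
proof -
  obtain V where V: "finite V" "V \<subseteq> integer_points" "S = convex hull V"
    using assms(1) by (auto simp: lattice_polytope_def)
  show ?thesis
    unfolding lattice_polytope_def
  proof (intro exI conjI)
    show "(+) v ` S = convex hull ((+) v ` V)"
      unfolding V(3) by (rule convex_hull_translation[symmetric])
  qed (use V assms(2) in \<open>auto intro: integer_points_add\<close>)
qed

text \<open>Integer translations permute the lattice and carry interiors along, so a translate by
  \<open>v\<close> is Fano exactly when \<open>- v\<close> is the only interior lattice
  point.\<close>

lemma ex_fano_translate_iff:
  fixes S :: "(real ^ 'n) set"
  assumes "lattice_polytope S"
  shows "(\<exists>Q. fano_polytope Q \<and> translation_equivalent S Q) \<longleftrightarrow>
    (\<exists>p. interior S \<inter> integer_points = {p})"
proof
  assume "\<exists>Q. fano_polytope Q \<and> translation_equivalent S Q"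
  then obtain v where v: "v \<in> integer_points" and F: "fano_polytope ((+) v ` S)"
    by (auto simp: translation_equivalent_def)
  have "(+) v ` interior S \<inter> integer_points = {0}"
    using F by (simp add: fano_polytope_def minus_frontier interior_translation)
  have "interior S \<inter> integer_points = {- v}"
  proof (intro equalityI subsetI)
    fix x assume "x \<in> interior S \<inter> integer_points"
    then have "v + x \<in> (+) v ` interior S \<inter> integer_points"
      using v by (auto intro: integer_points_add)
    then have "v + x = 0" using \<open>_ = {0}\<close> by auto
    then show "x \<in> {- v}" by (simp add: eq_neg_iff_add_eq_0 add.commute)
  next
    fix x assume "x \<in> {- v}"
    moreover have "0 \<in> (+) v ` interior S" using \<open>_ = {0}\<close> by auto
    ultimately show "x \<in> interior S \<inter> integer_points"
      using v by (auto simp: integer_points_minus neg_eq_iff_add_eq_0 add_eq_0_iff)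
  qed
  then show "\<exists>p. interior S \<inter> integer_points = {p}" by blast
next
  assume "\<exists>p. interior S \<inter> integer_points = {p}"
  then obtain p where p: "interior S \<inter> integer_points = {p}" by blast
  have pi: "p \<in> integer_points" and "p \<in> interior S" using p by auto
  have "(+) (- p) ` interior S \<inter> integer_points = {0}"
  proof (intro equalityI subsetI)
    fix y assume "y \<in> (+) (- p) ` interior S \<inter> integer_points"
    then obtain x where x: "x \<in> interior S" "y = - p + x" "y \<in> integer_points" by auto
    then have "x \<in> integer_points"
      using integer_points_add[OF pi, of y] by simp
    then show "y \<in> {0}" using x p by auto
  next
    fix y :: "real ^ 'n" assume "y \<in> {0}"
    then show "y \<in> (+) (- p) ` interior S \<inter> integer_points"
      using \<open>p \<in> interior S\<close> by (auto simp: integer_points_def image_iff intro!: bexI[of _ p])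
  qed
  \<comment> \<open>Full dimension comes for free from the existence of an interior point.\<close>
  moreover have "aff_dim S = int CARD('n)"
    using low_dim_interior[of S] \<open>p \<in> interior S\<close> by auto
  ultimately have "fano_polytope ((+) (- p) ` S)"
    using lattice_polytope_translation[OF assms integer_points_minus[OF pi]]
    by (simp add: fano_polytope_def minus_frontier interior_translation aff_dim_translation_eq
        del: uminus_add_conv_diff)
  moreover have "translation_equivalent S ((+) (- p) ` S)"
    unfolding translation_equivalent_def using integer_points_minus[OF pi] by blast
  ultimately show "\<exists>Q. fano_polytope Q \<and> translation_equivalent S Q" by blast
qed

lemma Ints_less_imp_le:
  fixes x y :: real
  assumes "x \<in> \<int>" "y \<in> \<int>" "x < y"
  shows "x + 1 \<le> y"
  using assms by (auto elim!: Ints_cases)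

section \<open>Interior lattice points on the constant block\<close>

locale lecture_hall_increasing = lecture_hall d s c
  for d s and c :: "nat \<Rightarrow> 'n::finite" +
  fixes i :: nat
  assumes i_pos: "1 \<le> i" and i_le: "i \<le> d"
    and s_const: "\<And>j. j \<in> {1..i} \<Longrightarrow> s j = s 1"
    and s_less: "\<And>j. j \<in> {i..<d} \<Longrightarrow> s j < s (Suc j)"
begin

lemma s1_pos: "s 1 > 0"
  using s_pos d_pos by simp

text \<open>Equal denominators on the block reduce the comparison of ratios to one of integers,
  where a strict inequality leaves a gap of 1.\<close>

lemma interior_lattice_step:
  assumes "x \<in> interior P" "x \<in> integer_points" "j \<in> {1..<i}"
  shows "x $ c j + 1 \<le> x $ c (Suc j)"
proof (rule Ints_less_imp_le)
  show "x $ c j \<in> \<int>" "x $ c (Suc j) \<in> \<int>"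
    using assms(2) by (auto simp: integer_points_def)
  have "s j = s 1" "s (Suc j) = s 1"
    using s_const[of j] s_const[of "Suc j"] assms(3) by auto
  then show "x $ c j < x $ c (Suc j)"
    using interior_ratio_less[OF assms(1), of j] assms(3) i_le s1_pos
    by (simp add: divide_less_cancel)
qed

lemma interior_lattice_ge:
  assumes x: "x \<in> interior P" "x \<in> integer_points" and j: "j \<in> {1..i}"
  shows "real j \<le> x $ c j"
proof -
  have "1 \<le> j" using j by simp
  then show ?thesis using j
  proof (induction rule: dec_induct)
    case base
    show ?case
      using interior_first_pos[OF x(1)] x(2) Ints_less_imp_le[of 0 "x $ c 1"]
      by (simp add: integer_points_def)
  next
    case (step k)
    then show ?case using interior_lattice_step[OF x, of k] by simp
  qed
qed

text \<open>Downward induction from x_i \<le> s_1 - 1, losing 1 at each step.\<close>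

lemma interior_lattice_le:
  assumes x: "x \<in> interior P" "x \<in> integer_points" and j: "j \<in> {1..i}"
  shows "x $ c j + real i + 1 \<le> real (s 1) + real j"
proof -
  have "j \<le> i" using j by simp
  then show ?thesis using j
  proof (induction rule: inc_induct)
    case base
    show ?case
      using interior_less[OF x(1), of i] x(2) i_pos i_le s_const[of i]
        Ints_less_imp_le[of "x $ c i" "real (s i)"]
      by (simp add: integer_points_def)
  next
    case (step k)
    then show ?case using interior_lattice_step[OF x, of k] by simp
  qed
qed

lemma interior_lattice_point_ge:
  assumes "interior P \<inter> integer_points \<noteq> {}"
  shows "i + 1 \<le> s 1"
proof -
  obtain x where "x \<in> interior P" "x \<in> integer_points" using assms by blast
  from interior_lattice_ge[OF this, of i] interior_lattice_le[OF this, of i]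
  show ?thesis using i_pos by simp
qed

text \<open>The test points for uniqueness: \<open>m\<close> shifts the block (1, ..., i), and
  \<open>t\<close> marks the one later coordinate whose distance to s_t is 2 instead of 1. The form
  s_j - e_j matches \<open>point_in_interior\<close>.\<close>

definition cand :: "nat \<Rightarrow> nat \<Rightarrow> real ^ 'n" where
  "cand m t = point (\<lambda>j. real (s j) -
     (if j \<le> i then real (s 1) - real j - real m else if j = t then 2 else 1))"

lemma cand_nth:
  "j \<in> {1..i} \<Longrightarrow> cand m t $ c j = real j + real m"
  "j \<in> {i+1..d} \<Longrightarrow> cand m t $ c j = real (s j) - (if j = t then 2 else 1)"
  using i_le s_const[of j] by (auto simp: cand_def)

lemma cand_integer: "cand m t \<in> integer_points"
  by (auto simp: integer_points_iff cand_def)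

(* The index 0 for t stands for no exceptional coordinate. *)
lemma cand_interior:
  assumes "i + m + 1 \<le> s 1"
    and t: "t = 0 \<or> (i + m + 1 = s 1 \<and> t \<in> {i+1..d} \<and> 2 * s (t - 1) < s t)"
  shows "cand m t \<in> interior P"
  unfolding cand_def
proof (rule point_in_interior, goal_cases)
  case 1
  show ?case using i_pos by simp
next
  case 2
  show ?case using assms(1) by (auto simp: i_le)
next
  case (3 j)
  consider "j < i" | "j = i" | "i < j" by linarith
  then show ?case
  proof cases
    case 1
    then have "s j = s 1" "s (Suc j) = s 1"
      using 3 s_const[of j] s_const[of "Suc j"] by auto
    then show ?thesis using 1 s1_pos by (simp add: mult_strict_right_mono)
  next
    case 2
    have less: "s j < s (Suc j)" using 2 3 s_less by simp
    show ?thesis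
    proof (cases "t = Suc j")
      case True
      \<comment> \<open>Here e_i = 1 because \<open>i + m + 1 = s 1\<close>, and e_(i+1) = 2, so the
        required inequality is exactly 2 s_i < s_(i+1).\<close>
      then have "2 * real (s j) < real (s (Suc j))" "real (s 1) = real i + real m + 1"
        using t by auto
      then show ?thesis using 2 True by simp
    next
      case False
      \<comment> \<open>Now e_(i+1) = 1, while e_i \<ge> 1 by the bound on \<open>m\<close>; strict
        growth of \<open>s\<close> is enough.\<close>
      have "real (s j) < 1 * real (s (Suc j))" using less by simp
      also have "\<dots> \<le> (real (s 1) - real i - real m) * real (s (Suc j))"
        by (rule mult_right_mono) (use assms(1) in auto)
      finally show ?thesis using 2 False by simp
    qed
  next
    case 3
    have less: "s j < s (Suc j)" using 3 \<open>j \<in> {1..<d}\<close> s_less by simp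
    moreover have "2 * s j < s (Suc j)" if "t = Suc j"
      using t that by auto
    ultimately show ?thesis using 3 by auto
  qed
qed

text \<open>If either condition fails, a second candidate besides \<open>cand 0 0\<close> lies in
  the interior.\<close>

lemma unique_imp:
  assumes p: "interior P \<inter> integer_points = {p}"
  shows "s 1 = i + 1" and "j \<in> {i..<d} \<Longrightarrow> s (Suc j) \<le> 2 * s j"
proof -
  have uniq: "cand m t = p" if "cand m t \<in> interior P" for m t
    using p that cand_integer by blast
  have ge: "i + 1 \<le> s 1" using interior_lattice_point_ge p by simp
  show s1: "s 1 = i + 1"
  proof (rule ccontr)
    assume "s 1 \<noteq> i + 1"
    \<comment> \<open>There is room for the shift by 1 since s_1 \<ge> i + 2; the two points differ
      in x_1.\<close>
    then have "cand 0 0 = cand 1 0"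
      using ge uniq[of 0 0] uniq[of 1 0] by (simp add: cand_interior)
    then have "cand 0 0 $ c 1 = cand 1 0 $ c 1" by simp
    then show False using i_pos by (simp add: cand_nth)
  qed
  show "s (Suc j) \<le> 2 * s j" if j: "j \<in> {i..<d}"
  proof (rule ccontr)
    assume "\<not> s (Suc j) \<le> 2 * s j"
    \<comment> \<open>As 2 s_j < s_(j+1), coordinate j + 1 may also take the value s_(j+1) -
      2.\<close>
    then have "cand 0 0 = cand 0 (Suc j)"
      using s1 j uniq[of 0 0] uniq[of 0 "Suc j"] by (simp add: cand_interior)
    then have "cand 0 0 $ c (Suc j) = cand 0 (Suc j) $ c (Suc j)" by simp
    then show False using j by (simp add: cand_nth)
  qed
qed

lemma unique_interior_lattice_point:
  assumes s1: "s 1 = i + 1" and le: "\<And>j. j \<in> {i..<d} \<Longrightarrow> s (Suc j) \<le> 2 * s j"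
  shows "interior P \<inter> integer_points = {cand 0 0}"
proof -
  have "x = cand 0 0" if x: "x \<in> interior P" "x \<in> integer_points" for x
  proof -
    \<comment> \<open>For s_1 = i + 1 the lower and upper bounds on the block coincide.\<close>
    have low: "x $ c j = real j" if "j \<in> {1..i}" for j
      using interior_lattice_ge[OF x that] interior_lattice_le[OF x that] s1 by simp
    \<comment> \<open>The induction starts at the last block index \<open>i\<close>, where x_i = i =
      s_i - 1 is already known.\<close>
    have high: "x $ c j = real (s j) - 1" if "i \<le> j" "j \<le> d" for j
      using that
    proof (induction rule: dec_induct)
      case base
      show ?case using low[of i] i_pos s_const[of i] s1 by simp
    next
      case (step k)
      have k: "k \<in> {1..<d}" using step i_pos by simp
      have pos: "real (s k) > 0" "real (s (Suc k)) > 0" using k s_pos by auto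
      have bound: "real (s (Suc k)) \<le> 2 * real (s k)"
        using le[of k] step by simp
      have "(real (s k) - 1) * real (s (Suc k)) < x $ c (Suc k) * real (s k)"
        using interior_ratio_less[OF x(1) k] pos step by (simp add: field_simps)
      \<comment> \<open>The bound s_(k+1) \<le> 2 s_k says precisely that (s_k - 1) s_(k+1) \<ge>
        (s_(k+1) - 2) s_k. Integrality then leaves only s_(k+1) - 1 strictly between s_(k+1) - 2 and
        s_(k+1).\<close>
      then have "(real (s (Suc k)) - 2) * real (s k) < x $ c (Suc k) * real (s k)"
        using bound by (simp add: algebra_simps)
      then have "real (s (Suc k)) - 2 < x $ c (Suc k)"
        using pos by (simp add: mult_less_cancel_right)
      then have "real (s (Suc k)) - 2 + 1 \<le> x $ c (Suc k)"
        using x(2) by (intro Ints_less_imp_le) (auto simp: integer_points_def)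
      moreover have "x $ c (Suc k) + 1 \<le> real (s (Suc k))"
        using x(2) interior_less[OF x(1), of "Suc k"] step
        by (intro Ints_less_imp_le) (auto simp: integer_points_def)
      ultimately show ?case by simp
    qed
    show ?thesis
      unfolding vec_eq_coords
    proof
      fix j assume "j \<in> {1..d}"
      then show "x $ c j = cand 0 0 $ c j"
        using low[of j] high[of j] cand_nth[of j 0 0] by (cases "j \<le> i") auto
    qed
  qed
  moreover have "cand 0 0 \<in> interior P"
    using s1 by (simp add: cand_interior)
  ultimately show ?thesis using cand_integer by blast
qed

end

theorem theorem2p5:
  fixes d i :: nat and s :: "nat \<Rightarrow> nat" and c :: "nat \<Rightarrow> 'n::finite"
  assumes "d \<ge> 1"
    and "bij_betw c {1..d} UNIV"
    and "\<forall>j \<in> {1..d}. s j > 0"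
    and "1 \<le> i" and "i \<le> d"
    and "\<forall>j \<in> {1..i}. s j = s 1"
    and "\<forall>j \<in> {i..<d}. s j < s (j + 1)"
  shows
    "((\<exists>Q :: (real ^ 'n) set. fano_polytope Q \<and>
          translation_equivalent (lecture_hall_polytope c d s) Q) \<longleftrightarrow>
        (\<forall>j \<in> {1..i}. s j = i + 1) \<and> (\<forall>j \<in> {i..<d}. s (j + 1) \<le> 2 * s j)) \<and>
     ((\<forall>j \<in> {1..i}. s j = i + 1) \<and> (\<forall>j \<in> {i..<d}. s (j + 1) \<le> 2 * s j) \<longrightarrow>
        (\<exists>p :: real ^ 'n.
           interior (lecture_hall_polytope c d s) \<inter> integer_points = {p} \<and>
           (\<forall>j \<in> {1..i}. p $ c j = real j) \<and>
           (\<forall>j \<in> {i+1..d}. p $ c j = real (s j) - 1)))"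
proof -
  interpret lecture_hall_increasing d s c i
    by unfold_locales (use assms in \<open>metis Suc_eq_plus1\<close>)+
  let ?C = "(\<forall>j \<in> {1..i}. s j = i + 1) \<and> (\<forall>j \<in> {i..<d}. s (j + 1) \<le> 2 * s j)"
  \<comment> \<open>Once the Fano condition is replaced by uniqueness, the point
    \<open>cand 0 0\<close> settles both the direction from \<open>?C\<close> and the final
    claim.\<close>
  have fano: "(\<exists>Q :: (real ^ 'n) set. fano_polytope Q \<and> translation_equivalent P Q) \<longleftrightarrow>
      (\<exists>p. interior P \<inter> integer_points = {p})"
    by (rule ex_fano_translate_iff[OF lattice_polytope_P])
  have unique: "interior P \<inter> integer_points = {cand 0 0}" if ?C
    using that i_pos by (intro unique_interior_lattice_point) auto
  moreover have ?C if p: "interior P \<inter> integer_points = {p}" for p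
  proof -
    have "s j = i + 1" if "j \<in> {1..i}" for j
      using unique_imp(1)[OF p] s_const[OF that] by simp
    then show ?thesis using unique_imp(2)[OF p] by simp
  qed
  moreover have "(\<forall>j \<in> {1..i}. cand 0 0 $ c j = real j) \<and>
      (\<forall>j \<in> {i+1..d}. cand 0 0 $ c j = real (s j) - 1)"
    by (auto simp: cand_nth)
  ultimately show ?thesis unfolding fano by blast
qed

end
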